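(* Given a fractional laminar cut family $\mathcal{C}$ feasible for the CSCP on a graph $G$ with integral edge capacities $c_e$, the algorithm Round-1 produces an integral family of cuts $\mathcal{A}$ that is feasible for the CSCP on $G$ with edge capacities $c_e+1$.
   Context: CSCP (common-sink $s$-$t$ cut packing): an undirected graph $G=(V,E)$ with positive integral edge capacities $c_e$, a sink $t\in V$, and $k$ commodities $S_1,\dots,S_k$, each consisting of exactly two terminals, one residing at $t$; terminal $i$ resides at vertex $r_i$, and the two terminals of a commodity reside at different vertices. A cut is a set $C$ with $\emptyset\subsetneq C\subsetneq V$; $\delta(C)$ is the set of edges with exactly one endpoint in $C$. Two cuts $C_1,C_2$ cross if $C_1\cap C_2$, $C_1\setminus C_2$, $C_2\setminus C_1$ are all non-empty. A collection of cuts is laminar if no two of its members cross. A fractional laminar cut family $\mathcal{C}$ for a terminal set $T$ with weight function $w$ is a laminar collection of cuts, each cut being associated with a unique terminal of $T$ (the same vertex set may occur several times), such that, writing $\mathcal{C}_i$ for the cuts associated with $i$, every $C\in\mathcal{C}_i$ contains $r_i$, and $\sum_{C\in\mathcal{C}_i}w(C)=1$ for every $i\in T$. Its load on $e$ is $\ell_e^{\mathcal{C}}=\sum_{C\in\mathcal{C}:\,e\in\delta(C)}w(C)$. The family is feasible for the CSCP with edge capacities $c'_e$ if (1) $T$ is the set of all terminals in $\bigcup_a S_a$ other than those at the sink $t$; (2) $t\notin\bigcup_{C\in\mathcal{C}}C$; (3) $\ell_e^{\mathcal{C}}\le c'_e$ for every $e\in E$. An integral family $\mathcal{A}=\{A_i\}_{i\in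 T}$ (one cut per terminal in $T$) is feasible for the CSCP with edge capacities $c'_e$ if $r_i\in A_i$ and $t\notin A_i$ for every $i\in T$, and $\ell_e^{\mathcal{A}}=|\{i\in T: e\in\delta(A_i)\}|\le c'_e$ for every $e\in E$. Notation (always for the current $\mathcal{C}$): $K_v$ is the set of cuts in $\mathcal{C}$ containing vertex $v$; the depth of $v$ is $\sum_{C\in K_v}w(C)$; the depth of a terminal is that of the vertex at which it resides. For a set of cuts $L=\{L_1,\dots,L_l\}$ with $L_1\subseteq L_2\subseteq\cdots\subseteq L_l$ and weights $w$, $L^x$ denotes the innermost cuts of $L$ of weight exactly $x$: if $l'$ is such that $\sum_{a<l'}w(L_a)<x\le\sum_{a\le l'}w(L_a)$, then $L^x=\{L_1,\dots,L_{l'}\}$ with weights $w'(L_a)=w(L_a)$ for $a<l'$ and $w'(L_{l'})=x-\sum_{a<l'}w(L_a)$. $M(v)$ is the current meta-node (set of merged vertices) containing $v$. Algorithm Round-1. Input: $G$, $c_e$, the terminals $T$ with the fractional laminar cut family $\mathcal{C}$, and the common sink $t\notin\bigcup_{C\in\mathcal{C}}C$. Output: a collection $\mathcal{A}$ of cuts, one for each terminal in $T$. (1) Set $T'=T$, $\mathcal{A}=\emptyset$, $M(v)=\{v\}$ for all $v\in V$; compute the depths of vertices and terminals. (2) While there are terminals in $T'$: (a) Let $i$ be a terminal of maximum depth in $T'$. Let $A_i=M(r_i)$; add $A_i$ to $\mathcal{A}$ and remove $i$ from $T'$. (b) Let $K=K_{r_i}^1$. Remove the cuts in $K\cap\mathcal{C}_i$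 from $K$, $\mathcal{C}_i$ and $\mathcal{C}$. While there is a terminal $j\in T'$ with a cut $C\in K\cap\mathcal{C}_j$: let $w=w(C)$; remove $C$ from $K$, $\mathcal{C}_j$ and $\mathcal{C}$; remove the cuts in $\mathcal{C}_i^{w}$ from $\mathcal{C}_i$ and add them to $\mathcal{C}_j$ (i.e. reassign them from $i$ to $j$). (c) If there is an edge $e=(u,v)$ with $\ell_e^{\mathcal{C}}=0$, merge the meta-nodes $M(u)$ and $M(v)$. (d) Recompute the depths of vertices and terminals. *)

theory Defs
  imports Complex_Main "HOL-Library.Multiset"
begin

text \<open>
  Edges are two-element sets of vertices. Terminals are elements of an arbitrary type and
  terminal \<open>i\<close> resides at the vertex \<open>r i\<close>; several terminals may reside at one vertex.
  The commodities are \<open>S 1, \<dots>, S k\<close>; they are not required to be pairwise disjoint.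
\<close>

locale cscp =
  fixes V :: "'v set" and E :: "'v set set" and c :: "'v set \<Rightarrow> nat" and t :: 'v
    and k :: nat and S :: "nat \<Rightarrow> 'i set" and r :: "'i \<Rightarrow> 'v"
  assumes finite_vertices: "finite V"
    and edges: "e \<in> E \<Longrightarrow> e \<subseteq> V \<and> card e = 2"
    and capacity_pos: "e \<in> E \<Longrightarrow> 0 < c e"
    and sink: "t \<in> V"
    and two_terminals: "a \<in> {1..k} \<Longrightarrow> card (S a) = 2"
    and residence: "a \<in> {1..k} \<Longrightarrow> i \<in> S a \<Longrightarrow> r i \<in> V"
    and terminal_at_sink: "a \<in> {1..k} \<Longrightarrow> \<exists>i\<in>S a. r i = t"
    and distinct_residence: "a \<in> {1..k} \<Longrightarrow> inj_on r (S a)"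

definition is_cut :: "'v set \<Rightarrow> 'v set \<Rightarrow> bool" where
  "is_cut V C \<longleftrightarrow> {} \<subset> C \<and> C \<subset> V"

definition boundary :: "'v set set \<Rightarrow> 'v set \<Rightarrow> 'v set set" where
  "boundary E C = {e \<in> E. card (e \<inter> C) = 1}"

definition crossing :: "'v set \<Rightarrow> 'v set \<Rightarrow> bool" where
  "crossing C D \<longleftrightarrow> C \<inter> D \<noteq> {} \<and> C - D \<noteq> {} \<and> D - C \<noteq> {}"

text \<open>
  A family of weighted cuts is a multiset, so that one vertex set may occur several times.
  The field \<open>owner\<close> is the terminal with which the cut is associated.
\<close>

record ('i, 'v) wcut =
  owner :: 'i
  verts :: "'v set"
  wt :: real

type_synonym ('i, 'v) family = "('i, 'v) wcut multiset"

definition weight :: "('i, 'v) family \<Rightarrow> real" where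
  "weight L = (\<Sum>C\<in>#L. wt C)"

definition owned :: "('i, 'v) family \<Rightarrow> 'i \<Rightarrow> ('i, 'v) family" where
  "owned \<C> i = filter_mset (\<lambda>C. owner C = i) \<C>"

definition cuts_at :: "('i, 'v) family \<Rightarrow> 'v \<Rightarrow> ('i, 'v) family" where
  "cuts_at \<C> v = filter_mset (\<lambda>C. v \<in> verts C) \<C>"

definition depth :: "('i, 'v) family \<Rightarrow> 'v \<Rightarrow> real" where
  "depth \<C> v = weight (cuts_at \<C> v)"

definition load :: "'v set set \<Rightarrow> ('i, 'v) family \<Rightarrow> 'v set \<Rightarrow> real" where
  "load E \<C> e = weight (filter_mset (\<lambda>C. e \<in> boundary E (verts C)) \<C>)"

definition fractional_laminar_family ::
    "'v set \<Rightarrow> ('i \<Rightarrow> 'v) \<Rightarrow> 'i set \<Rightarrow> ('i, 'v) family \<Rightarrow> bool" where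
  "fractional_laminar_family V r T \<C> \<longleftrightarrow>
     (\<forall>C\<in>#\<C>. is_cut V (verts C) \<and> 0 \<le> wt C \<and> owner C \<in> T \<and> r (owner C) \<in> verts C) \<and>
     (\<forall>C\<in>#\<C>. \<forall>D\<in>#\<C>. \<not> crossing (verts C) (verts D)) \<and>
     (\<forall>i\<in>T. weight (owned \<C> i) = 1)"

definition fractional_feasible ::
    "'v set set \<Rightarrow> 'v \<Rightarrow> nat \<Rightarrow> (nat \<Rightarrow> 'i set) \<Rightarrow> ('i \<Rightarrow> 'v) \<Rightarrow> ('v set \<Rightarrow> nat)
      \<Rightarrow> 'i set \<Rightarrow> ('i, 'v) family \<Rightarrow> bool" where
  "fractional_feasible E t k S r c' T \<C> \<longleftrightarrow>
     T = {i \<in> (\<Union>a\<in>{1..k}. S a). r i \<noteq> t} \<and>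
     t \<notin> (\<Union>C\<in>set_mset \<C>. verts C) \<and>
     (\<forall>e\<in>E. load E \<C> e \<le> real (c' e))"

text \<open>An integral family assigns one cut to each terminal in \<open>T\<close> and nothing else.\<close>

definition integral_feasible ::
    "'v set \<Rightarrow> 'v set set \<Rightarrow> 'v \<Rightarrow> ('i \<Rightarrow> 'v) \<Rightarrow> ('v set \<Rightarrow> nat)
      \<Rightarrow> 'i set \<Rightarrow> ('i \<rightharpoonup> 'v set) \<Rightarrow> bool" where
  "integral_feasible V E t r c' T \<A> \<longleftrightarrow>
     dom \<A> = T \<and>
     (\<forall>i\<in>T. is_cut V (the (\<A> i)) \<and> r i \<in> the (\<A> i) \<and> t \<notin> the (\<A> i)) \<and>
     (\<forall>e\<in>E. card {i \<in> T. e \<in> boundary E (the (\<A> i))} \<le> c' e)"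

text \<open>
  \<open>innermost x L P R\<close>: the chain \<open>L\<close> splits into its innermost cuts \<open>P\<close> of weight exactly \<open>x\<close>
  and the rest \<open>R\<close>. The cut \<open>Ls ! l\<close> at which weight \<open>x\<close> is reached contributes the missing
  weight to \<open>P\<close>, and a copy carrying the left-over weight, if there is any, stays in \<open>R\<close>.
  This is a relation because copies of the same vertex set can be ordered arbitrarily.
  For \<open>x = 0\<close>, where no index \<open>l\<close> exists, \<open>P\<close> is empty.
\<close>

definition innermost ::
    "real \<Rightarrow> ('i, 'v) family \<Rightarrow> ('i, 'v) family \<Rightarrow> ('i, 'v) family \<Rightarrow> bool" where
  "innermost x L P R \<longleftrightarrow>
     (if x = 0 then P = {#} \<and> R = L
      else \<exists>Ls l. mset Ls = L \<and> sorted_wrt (\<lambda>C D. verts C \<subseteq> verts D) Ls \<and> l < length Ls \<and>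
        (let s = (\<Sum>C\<leftarrow>take l Ls. wt C); s' = s + wt (Ls ! l)
         in s < x \<and> x \<le> s' \<and>
            P = mset (take l Ls) + {#(Ls ! l)\<lparr>wt := x - s\<rparr>#} \<and>
            R = (if x < s' then {#(Ls ! l)\<lparr>wt := s' - x\<rparr>#} else {#}) + mset (drop (Suc l) Ls)))"

text \<open>
  Round-1 is given as a small-step transition system, because the choices of the terminal of
  maximum depth, of the next cut to be exchanged and of the order among equal vertex sets are
  left open. \<open>Select\<close> is the head of the outer loop. In \<open>Reassign i K\<close> the loop that exchanges
  the cuts of \<open>K\<close> is running; the cuts of \<open>K\<close> are then still part of the family. In \<open>Merge\<close>
  the meta-nodes are merged along the edges of zero load, until no such edge is left between
  different meta-nodes. Depths and loads are functions of the current family and therefore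
  need no recomputation step.
\<close>

datatype ('i, 'v) phase = Select | Reassign 'i "('i, 'v) family" | Merge

record ('i, 'v) state =
  pending :: "'i set"
  result :: "'i \<rightharpoonup> 'v set"
  fam :: "('i, 'v) family"
  meta :: "'v \<Rightarrow> 'v set"
  phase :: "('i, 'v) phase"

definition round1_init :: "'i set \<Rightarrow> ('i, 'v) family \<Rightarrow> ('i, 'v) state" where
  "round1_init T \<C> =
     \<lparr>pending = T, result = Map.empty, fam = \<C>, meta = (\<lambda>v. {v}), phase = Select\<rparr>"

definition merge_nodes :: "('v \<Rightarrow> 'v set) \<Rightarrow> 'v \<Rightarrow> 'v \<Rightarrow> 'v \<Rightarrow> 'v set" where
  "merge_nodes M u v = (\<lambda>x. if x \<in> M u \<union> M v then M u \<union> M v else M x)"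

inductive round1_step ::
    "'v set set \<Rightarrow> ('i \<Rightarrow> 'v) \<Rightarrow> ('i, 'v) state \<Rightarrow> ('i, 'v) state \<Rightarrow> bool"
  for E :: "'v set set" and r :: "'i \<Rightarrow> 'v" where
  select:
    "i \<in> T' \<Longrightarrow> \<forall>j\<in>T'. depth \<C> (r j) \<le> depth \<C> (r i) \<Longrightarrow>
     innermost 1 (cuts_at \<C> (r i)) K R \<Longrightarrow>
     K' = K - owned K i \<Longrightarrow>
     round1_step E r
       \<lparr>pending = T', result = \<A>, fam = \<C>, meta = M, phase = Select\<rparr>
       \<lparr>pending = T' - {i}, result = \<A>(i \<mapsto> M (r i)),
        fam = \<C> - cuts_at \<C> (r i) + R + K', meta = M, phase = Reassign i K'\<rparr>"
| reassign:
    "C \<in># K \<Longrightarrow> owner C = j \<Longrightarrow> j \<in> T' \<Longrightarrow>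
     innermost (wt C) (owned \<C> i) P R \<Longrightarrow>
     round1_step E r
       \<lparr>pending = T', result = \<A>, fam = \<C>, meta = M, phase = Reassign i K\<rparr>
       \<lparr>pending = T', result = \<A>,
        fam = \<C> - {#C#} - owned \<C> i + R + image_mset (\<lambda>D. D\<lparr>owner := j\<rparr>) P,
        meta = M, phase = Reassign i (K - {#C#})\<rparr>"
| reassign_done:
    "\<forall>C\<in>#K. owner C \<notin> T' \<Longrightarrow>
     round1_step E r
       \<lparr>pending = T', result = \<A>, fam = \<C>, meta = M, phase = Reassign i K\<rparr>
       \<lparr>pending = T', result = \<A>, fam = \<C>, meta = M, phase = Merge\<rparr>"
| merge:
    "{u, v} \<in> E \<Longrightarrow> load E \<C> {u, v} = 0 \<Longrightarrow> M u \<noteq> M v \<Longrightarrow>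
     round1_step E r
       \<lparr>pending = T', result = \<A>, fam = \<C>, meta = M, phase = Merge\<rparr>
       \<lparr>pending = T', result = \<A>, fam = \<C>, meta = merge_nodes M u v, phase = Merge\<rparr>"
| merge_done:
    "\<forall>u v. {u, v} \<in> E \<and> load E \<C> {u, v} = 0 \<longrightarrow> M u = M v \<Longrightarrow>
     round1_step E r
       \<lparr>pending = T', result = \<A>, fam = \<C>, meta = M, phase = Merge\<rparr>
       \<lparr>pending = T', result = \<A>, fam = \<C>, meta = M, phase = Select\<rparr>"

definition round1_finished :: "('i, 'v) state \<Rightarrow> bool" where
  "round1_finished s \<longleftrightarrow> phase s = Select \<and> pending s = {}"

end

theory Submission
  imports Defs
begin

text \<open>
  When \<open>i\<close> is selected, the cuts in \<open>K - \<C>\<^sub>i\<close> weigh exactly as much as the cuts of \<open>i\<close> outside \<open>K\<close>.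
  So the exchange loop never gets stuck, every pending terminal keeps total weight 1, and finally
  no cut of positive weight is owned by a processed terminal. Consider an edge \<open>{u, v}\<close> crossed by
  \<open>A\<^sub>i = M (r i)\<close> with \<open>u\<close> inside. As \<open>i\<close> is deepest, the cuts containing only \<open>v\<close> weigh at most as much
  as the cuts containing only \<open>u\<close>. Removing \<open>K\<close> either decreases the load of the edge by 1 or leaves
  no cut that contains only \<open>u\<close>, and in the latter case the load that is left on the edge is less
  than 1 and allows one more crossing, after which \<open>u\<close> and \<open>v\<close> are merged.
\<close>

section \<open>Weights of families\<close>

text \<open>\<open>Q\<close> sees only owner and vertex set. Hence replacing a cut by two copies
  that share its weight changes no \<open>mass Q\<close>, and depths, loads and the weight per
  terminal are all instances.\<close>

definition mass :: "('i \<Rightarrow> 'v set \<Rightarrow> bool) \<Rightarrow> ('i, 'v) family \<Rightarrow> real" where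
  "mass Q F = weight (filter_mset (\<lambda>C. Q (owner C) (verts C)) F)"

abbreviation owner_mass :: "'i \<Rightarrow> ('i, 'v) family \<Rightarrow> real" where
  "owner_mass i \<equiv> mass (\<lambda>j _. j = i)"

text \<open>The load of an edge \<open>{u, v}\<close> is split into \<open>side u v\<close> and
  \<open>side v u\<close>, because the choice of a deepest terminal bounds one of them by the
  other.\<close>

abbreviation side :: "'v \<Rightarrow> 'v \<Rightarrow> ('i, 'v) family \<Rightarrow> real" where
  "side u v \<equiv> mass (\<lambda>_ A. u \<in> A \<and> v \<notin> A)"

lemma weight_simps [simp]:
  "weight {#} = 0" "weight (add_mset C F) = wt C + weight F" "weight (F + G) = weight F + weight G"
  by (simp_all add: weight_def)

lemma mass_simps [simp]:
  "mass Q {#} = 0"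
  "mass Q (add_mset C F) = (if Q (owner C) (verts C) then wt C else 0) + mass Q F"
  "mass Q (F + G) = mass Q F + mass Q G"
  by (simp_all add: mass_def)

lemma mass_diff: "G \<subseteq># F \<Longrightarrow> mass Q (F - G) = mass Q F - mass Q G"
  by (metis add_diff_cancel_right' mass_simps(3) subset_mset.diff_add)

lemma weight_eq_mass: "weight F = mass (\<lambda>_ _. True) F"
  by (simp add: mass_def)

lemma mass_filter:
  "mass Q (filter_mset (\<lambda>C. P (owner C) (verts C)) F) = mass (\<lambda>i A. P i A \<and> Q i A) F"
  by (induction F) auto

lemma diff_filter_mset: "F - filter_mset P F = filter_mset (\<lambda>x. \<not> P x) F"
  by (metis add_diff_cancel_left' multiset_partition)

lemma mass_split: "mass Q F = mass (\<lambda>i A. Q i A \<and> P i A) F + mass (\<lambda>i A. Q i A \<and> \<not> P i A) F"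
  by (induction F) auto

lemma mass_set_owner: "mass Q (image_mset (\<lambda>D. D\<lparr>owner := j\<rparr>) F) = mass (\<lambda>_. Q j) F"
  by (induction F) auto

lemma depth_eq_mass: "depth F v = mass (\<lambda>_ A. v \<in> A) F"
  by (simp add: depth_def cuts_at_def mass_def)

definition nonneg :: "('i, 'v) family \<Rightarrow> bool" where
  "nonneg F \<longleftrightarrow> (\<forall>C\<in>#F. 0 \<le> wt C)"

text \<open>Cuts of weight 0 contribute nothing, so the predicates are compared on positive weight
  only. In this form \<open>meta_ok\<close>, which ignores cuts of weight 0, can be applied.\<close>

lemma mass_mono:
  assumes "nonneg F" "\<And>C. C \<in># F \<Longrightarrow> 0 < wt C \<Longrightarrow> Q (owner C) (verts C) \<Longrightarrow> Q' (owner C) (verts C)"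
  shows "mass Q F \<le> mass Q' F"
  using assms
proof (induction F)
  case (add C F)
  have "mass Q F \<le> mass Q' F" using add by (simp add: nonneg_def)
  moreover have "0 \<le> wt C" "0 < wt C \<Longrightarrow> Q (owner C) (verts C) \<Longrightarrow> Q' (owner C) (verts C)"
    using add.prems by (auto simp: nonneg_def)
  ultimately show ?case by (cases "wt C = 0") auto
qed simp

lemma mass_cong:
  assumes "nonneg F" "\<And>C. C \<in># F \<Longrightarrow> 0 < wt C \<Longrightarrow> Q (owner C) (verts C) \<longleftrightarrow> Q' (owner C) (verts C)"
  shows "mass Q F = mass Q' F"
  using mass_mono[of F Q Q'] mass_mono[of F Q' Q] assms by fastforce

lemma mass_False [simp]: "mass (\<lambda>_ _. False) F = 0"
  by (simp add: mass_def)

lemma mass_nonneg: "nonneg F \<Longrightarrow> 0 \<le> mass Q F"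
  using mass_mono[of F "\<lambda>_ _. False" Q] by simp

lemma mass_eq_0_iff:
  assumes "nonneg F"
  shows "mass Q F = 0 \<longleftrightarrow> (\<forall>C\<in>#F. 0 < wt C \<longrightarrow> \<not> Q (owner C) (verts C))"
  using assms
proof (induction F)
  case (add C F)
  then have "nonneg F" "0 \<le> wt C" by (auto simp: nonneg_def)
  then show ?case
    using add mass_nonneg[of F Q] by (auto simp: add_nonneg_eq_0_iff)
qed simp

lemma mass_le_weight: "nonneg F \<Longrightarrow> mass Q F \<le> weight F"
  using mass_mono[of F Q "\<lambda>_ _. True"] by (simp add: weight_eq_mass)

lemma nonneg_sub: "nonneg F \<Longrightarrow> G \<subseteq># F \<Longrightarrow> nonneg G"
  by (meson mset_subset_eqD nonneg_def)

section \<open>Innermost cuts of a chain\<close>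

text \<open>The pieces of a split cut are not members of the original family, so submultisets are
  too narrow. Multiplicities are ignored: the relation transports properties of single cuts and of
  pairs, while weights are tracked by \<open>mass\<close>.\<close>

definition refines :: "('i, 'v) family \<Rightarrow> ('i, 'v) family \<Rightarrow> bool" where
  "refines G F \<longleftrightarrow>
     (\<forall>D\<in>#G. \<exists>C\<in>#F. owner D = owner C \<and> verts D = verts C \<and> 0 \<le> wt D \<and> wt D \<le> wt C)"

lemma refines_sub: "nonneg F \<Longrightarrow> G \<subseteq># F \<Longrightarrow> refines G F"
  unfolding refines_def nonneg_def by (auto dest: mset_subset_eqD intro!: bexI)

lemma refines_trans: "refines H G \<Longrightarrow> refines G F \<Longrightarrow> refines H F"
  unfolding refines_def by (metis order_trans)

lemma refines_add: "refines G F \<Longrightarrow> refines H F \<Longrightarrow> refines (G + H) F"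
  unfolding refines_def by auto

lemma refinesE:
  assumes "refines G F" "D \<in># G"
  obtains C where "C \<in># F" "owner D = owner C" "verts D = verts C" "0 \<le> wt D" "wt D \<le> wt C"
  using assms unfolding refines_def by blast

lemma refines_nonneg: "refines G F \<Longrightarrow> nonneg G"
  unfolding refines_def nonneg_def by blast

lemma weight_mset: "weight (mset Ls) = (\<Sum>C\<leftarrow>Ls. wt C)"
  by (induction Ls) auto

text \<open>The cut at which weight \<open>x\<close> is reached is replaced by two copies whose
  weights add up to its own; an omitted second copy would have weight 0. All other cuts go to
  exactly one of \<open>P\<close> and \<open>R\<close>.\<close>

lemma innermost_split:
  assumes inner: "innermost x L P R" and "nonneg L"
  shows "mass Q P + mass Q R = mass Q L"
    and "weight P = x"
    and "refines P L" and "refines R L"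
    and "\<And>C D. C \<in># P \<Longrightarrow> D \<in># R \<Longrightarrow> verts C \<subseteq> verts D"
proof -
  have "(mass Q P + mass Q R = mass Q L) \<and> weight P = x \<and> refines P L \<and> refines R L \<and>
    (\<forall>C\<in>#P. \<forall>D\<in>#R. verts C \<subseteq> verts D)"
  proof (cases "x = 0")
    case True
    then show ?thesis using inner \<open>nonneg L\<close> refines_sub[of L]
      by (auto simp: innermost_def refines_def)
  next
    case False
    then obtain Ls l where Ls: "mset Ls = L" "sorted_wrt (\<lambda>C D. verts C \<subseteq> verts D) Ls"
      and l: "l < length Ls"
      and lt: "weight (mset (take l Ls)) < x" and le: "x \<le> weight (mset (take l Ls)) + wt (Ls ! l)"
      and P: "P = mset (take l Ls) + {#(Ls ! l)\<lparr>wt := x - weight (mset (take l Ls))\<rparr>#}"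
      and R: "R = (if x < weight (mset (take l Ls)) + wt (Ls ! l)
                 then {#(Ls ! l)\<lparr>wt := weight (mset (take l Ls)) + wt (Ls ! l) - x\<rparr>#} else {#})
               + mset (drop (Suc l) Ls)"
      using inner unfolding innermost_def weight_mset Let_def by auto
    define B where "B = Ls ! l"
    define U where "U = take l Ls"
    define W where "W = drop (Suc l) Ls"
    have Ls_eq: "Ls = U @ B # W" using l by (simp add: U_def B_def W_def id_take_nth_drop)
    have L_eq: "L = mset U + {#B#} + mset W" using Ls(1) Ls_eq by auto
    have chain: "\<forall>C\<in>set U. verts C \<subseteq> verts B" "\<forall>C\<in>set W. verts B \<subseteq> verts C"
      "\<forall>C\<in>set U. \<forall>D\<in>set W. verts C \<subseteq> verts D"
      using Ls(2) unfolding Ls_eq by (auto simp: sorted_wrt_append)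
    note lt = lt[folded B_def U_def W_def] and le = le[folded B_def U_def W_def]
      and P = P[folded B_def U_def W_def] and R = R[folded B_def U_def W_def]
    have nn: "nonneg (mset U)" "nonneg (mset W)" "0 \<le> wt B"
      using \<open>nonneg L\<close> by (auto simp: nonneg_def L_eq)
    have "mass Q P + mass Q R = mass Q L"
      using lt le unfolding P R L_eq by auto
    moreover have "weight P = x" unfolding P by auto
    moreover have "0 \<le> weight (mset U)" using nn(1) mass_nonneg unfolding weight_eq_mass by blast
    then have "refines P L" "refines R L"
      using nn lt le unfolding P R L_eq refines_def nonneg_def by auto
    moreover have "\<forall>C\<in>#P. \<forall>D\<in>#R. verts C \<subseteq> verts D"
      using chain unfolding P R by auto
    ultimately show ?thesis by blast
  qed
  then show "mass Q P + mass Q R = mass Q L" "weight P = x" "refines P L" "refines R L"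
    "\<And>C D. C \<in># P \<Longrightarrow> D \<in># R \<Longrightarrow> verts C \<subseteq> verts D" by auto
qed

lemma chain_sorted_list:
  assumes "\<forall>C\<in>#L. \<forall>D\<in>#L. verts C \<subseteq> verts D \<or> verts D \<subseteq> verts C"
  shows "\<exists>Ls. mset Ls = L \<and> sorted_wrt (\<lambda>C D. verts C \<subseteq> verts D) Ls"
  using assms
proof (induction "size L" arbitrary: L)
  case 0
  then show ?case by (intro exI[of _ "[]"]) auto
next
  case (Suc n)
  then have "verts ` set_mset L \<noteq> {}" by auto
  then obtain A where A: "A \<in> verts ` set_mset L" "\<And>B. B \<in> verts ` set_mset L \<Longrightarrow> B \<subseteq> A \<Longrightarrow> B = A"
    using finite_has_minimal[of "verts ` set_mset L"] by (metis finite_imageI finite_set_mset)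
  then obtain C where C: "C \<in># L" "A = verts C" by auto
  \<comment> \<open>In a chain a minimal vertex set lies below all others, so it can head the sorted
    list.\<close>
  have least: "\<forall>D\<in>#L. verts C \<subseteq> verts D" using A C Suc.prems by blast
  have "n = size (L - {#C#})" using Suc.hyps(2) C(1) by (simp add: size_Diff_singleton)
  moreover have "\<forall>C'\<in>#L - {#C#}. \<forall>D\<in>#L - {#C#}. verts C' \<subseteq> verts D \<or> verts D \<subseteq> verts C'"
    using Suc.prems by (meson in_diffD)
  ultimately obtain Ls where Ls: "mset Ls = L - {#C#}" "sorted_wrt (\<lambda>C D. verts C \<subseteq> verts D) Ls"
    using Suc.hyps(1) by blast
  have "\<forall>D\<in>set Ls. verts C \<subseteq> verts D" using least Ls(1) by (metis in_diffD set_mset_mset)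
  then show ?case using Ls C(1) by (intro exI[of _ "C # Ls"]) auto
qed

lemma innermost_exists:
  assumes chain: "\<forall>C\<in>#L. \<forall>D\<in>#L. verts C \<subseteq> verts D \<or> verts D \<subseteq> verts C"
    and "0 \<le> x" "x \<le> weight L"
  shows "\<exists>P R. innermost x L P R"
proof (cases "x = 0")
  case True
  then show ?thesis by (simp add: innermost_def)
next
  case False
  with assms have x: "0 < x" by simp
  obtain Ls where Ls: "mset Ls = L" "sorted_wrt (\<lambda>C D. verts C \<subseteq> verts D) Ls"
    using chain_sorted_list[OF chain] by blast
  define f where "f n = (\<Sum>C\<leftarrow>take n Ls. wt C)" for n
  have "x \<le> f (length Ls)" using assms(3) Ls(1) by (auto simp: f_def weight_mset[symmetric])
  then have ex: "x \<le> f (LEAST n. x \<le> f n)" and le: "(LEAST n. x \<le> f n) \<le> length Ls"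
    by (rule LeastI, rule Least_le)
  \<comment> \<open>The least number of cuts weighing at least \<open>x\<close> is positive because
    \<open>x\<close> is. Its predecessor is the index \<open>l\<close>, and the prefix of length
    \<open>l\<close> weighs less than \<open>x\<close>.\<close>
  have "(LEAST n. x \<le> f n) \<noteq> 0"
  proof
    assume "(LEAST n. x \<le> f n) = 0"
    then have "x \<le> f 0" using ex by simp
    then show False using x by (simp add: f_def)
  qed
  then obtain l where l: "(LEAST n. x \<le> f n) = Suc l" using not0_implies_Suc by blast
  have "\<not> x \<le> f l" using not_less_Least[of l "\<lambda>n. x \<le> f n"] l by simp
  moreover have "l < length Ls" using le l by simp
  moreover have "f (Suc l) = f l + wt (Ls ! l)"
    using \<open>l < length Ls\<close> by (simp add: f_def take_Suc_conv_app_nth)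
  ultimately have "(\<Sum>C\<leftarrow>take l Ls. wt C) < x" "x \<le> (\<Sum>C\<leftarrow>take l Ls. wt C) + wt (Ls ! l)"
    using ex l by (simp_all add: f_def)
  then have "innermost x L
      (mset (take l Ls) + {#(Ls ! l)\<lparr>wt := x - f l\<rparr>#})
      ((if x < f l + wt (Ls ! l) then {#(Ls ! l)\<lparr>wt := f l + wt (Ls ! l) - x\<rparr>#} else {#}) +
       mset (drop (Suc l) Ls))"
    unfolding innermost_def Let_def f_def using False Ls \<open>l < length Ls\<close>
    by (simp only: if_False) blast
  then show ?thesis by blast
qed

section \<open>The invariant\<close>

text \<open>
  For an edge \<open>{u, v}\<close> of capacity \<open>c\<close>, crossed so far by \<open>n\<close> output cuts, \<open>a\<close> and \<open>b\<close> are the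
  weights of the current cuts containing only \<open>u\<close> and only \<open>v\<close>. An output cut normally removes
  weight 1 from the edge, which keeps the first disjunct. The first cut that removes less leads to
  the second disjunct, the next one to the third.
\<close>

definition edge_bound :: "nat \<Rightarrow> nat \<Rightarrow> real \<Rightarrow> real \<Rightarrow> bool" where
  "edge_bound c n a b \<longleftrightarrow>
     real n + a + b \<le> real c \<or>
     (a = 0 \<or> b = 0) \<and> a + b < 1 \<and> n \<le> c \<or>
     a = 0 \<and> b = 0 \<and> n \<le> Suc c"

lemma edge_bound_mono:
  "edge_bound c n a b \<Longrightarrow> 0 \<le> a' \<Longrightarrow> a' \<le> a \<Longrightarrow> 0 \<le> b' \<Longrightarrow> b' \<le> b \<Longrightarrow> edge_bound c n a' b'"
  unfolding edge_bound_def by auto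

lemma edge_bound_commute: "edge_bound c n a b \<longleftrightarrow> edge_bound c n b a"
  unfolding edge_bound_def by auto

text \<open>Here \<open>q\<close> is the weight removed on the inner side, \<open>a\<close> the
  weight left there and \<open>b\<close> the weight on the outer side. If \<open>q = 1\<close>, only
  the first disjunct was possible and it persists. If \<open>q < 1\<close>, then
  \<open>a = 0\<close>, and the first disjunct leads to the second and the second to the
  third.\<close>

lemma edge_bound_cut:
  assumes "edge_bound c n (q + a) b" "a = 0 \<or> q = 1" "0 \<le> a" "0 \<le> q" "q \<le> 1"
    and "0 \<le> b" "b \<le> q + a" "0 < q + a + b"
  shows "edge_bound c (Suc n) a b"
proof (cases "q = 1")
  case True
  then show ?thesis using assms unfolding edge_bound_def by auto
next
  case False
  \<comment> \<open>As \<open>b\<close> is at most \<open>q\<close>, a positive load forces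
    \<open>0 < q\<close>, which rules out the third disjunct.\<close>
  then have [simp]: "a = 0" and q: "0 < q" "q < 1" "b < 1" using assms by auto
  from assms(1) consider "real n + q + b \<le> real c" | "b = 0" "n \<le> c"
    unfolding edge_bound_def using q by auto
  then show ?thesis
  proof cases
    case 1
    \<comment> \<open>Integrality of \<open>n\<close> and \<open>c\<close> turns this strict
      inequality into \<open>Suc n \<le> c\<close>.\<close>
    then have "real n < real c" using q assms by linarith
    then show ?thesis using q by (auto simp: edge_bound_def)
  qed (auto simp: edge_bound_def)
qed

lemma edge_bound_le: "edge_bound c n a b \<Longrightarrow> 0 \<le> a \<Longrightarrow> 0 \<le> b \<Longrightarrow> n \<le> Suc c"
  unfolding edge_bound_def by linarith

context cscp
begin

definition terminals :: "'i set" where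
  "terminals = {i \<in> (\<Union>a\<in>{1..k}. S a). r i \<noteq> t}"

definition family_ok :: "('i, 'v) family \<Rightarrow> bool" where
  "family_ok F \<longleftrightarrow> nonneg F \<and> (\<forall>C\<in>#F. r (owner C) \<in> verts C \<and> t \<notin> verts C) \<and>
     (\<forall>C\<in>#F. \<forall>D\<in>#F. \<not> crossing (verts C) (verts D))"

text \<open>The first two clauses make \<open>M\<close> the class map of an equivalence relation.
  The last one makes every cut of positive weight a union of meta-nodes; a cut of weight 0 may split
  a meta-node, since merging looks at loads only.\<close>

definition meta_ok :: "('i, 'v) family \<Rightarrow> ('v \<Rightarrow> 'v set) \<Rightarrow> bool" where
  "meta_ok F M \<longleftrightarrow> (\<forall>v. v \<in> M v) \<and> (\<forall>u v. u \<in> M v \<longrightarrow> M u = M v) \<and> (\<forall>v\<in>V. M v \<subseteq> V) \<and>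
     (\<forall>u v. \<forall>C\<in>#F. u \<in> M v \<longrightarrow> 0 < wt C \<longrightarrow> (u \<in> verts C \<longleftrightarrow> v \<in> verts C))"

definition result_ok :: "'i set \<Rightarrow> ('i \<rightharpoonup> 'v set) \<Rightarrow> bool" where
  "result_ok T' \<A> \<longleftrightarrow> T' \<subseteq> terminals \<and> dom \<A> = terminals - T' \<and>
     (\<forall>i\<in>dom \<A>. is_cut V (the (\<A> i)) \<and> r i \<in> the (\<A> i) \<and> t \<notin> the (\<A> i))"

text \<open>Cuts of weight 0 are exempt because the exchange loop may stop with such cuts left at
  processed terminals.\<close>

definition owners_in :: "'i set \<Rightarrow> ('i, 'v) family \<Rightarrow> bool" where
  "owners_in T' F \<longleftrightarrow> (\<forall>C\<in>#F. 0 < wt C \<longrightarrow> owner C \<in> T')"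

definition crossings :: "('i \<rightharpoonup> 'v set) \<Rightarrow> 'v set \<Rightarrow> nat" where
  "crossings \<A> e = card {i \<in> dom \<A>. e \<in> boundary E (the (\<A> i))}"

definition edges_ok :: "('i \<rightharpoonup> 'v set) \<Rightarrow> ('i, 'v) family \<Rightarrow> bool" where
  "edges_ok \<A> F \<longleftrightarrow> (\<forall>u v. {u, v} \<in> E \<longrightarrow>
     edge_bound (c {u, v}) (crossings \<A> {u, v}) (side u v F) (side v u F))"

text \<open>
  While the cuts of \<open>K\<close> are being exchanged, they no longer count towards the loads, although they
  still belong to the family. The disjunct on the empty result covers the first iteration, in which
  nothing has been merged yet.
\<close>

definition phase_ok :: "('i, 'v) state \<Rightarrow> bool" where
  "phase_ok s \<longleftrightarrow> (case phase s of
     Select \<Rightarrow> owners_in (pending s) (fam s) \<and> edges_ok (result s) (fam s) \<and>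
       (result s = Map.empty \<or>
        (\<forall>u v. {u, v} \<in> E \<and> load E (fam s) {u, v} = 0 \<longrightarrow> meta s u = meta s v))
   | Reassign i K \<Rightarrow> owners_in (insert i (pending s)) (fam s) \<and> edges_ok (result s) (fam s - K) \<and>
       K \<subseteq># fam s \<and> i \<notin> pending s \<and> (\<forall>C\<in>#K. owner C \<noteq> i) \<and>
       owner_mass i (fam s) = weight K \<and>
       (\<forall>C\<in>#K. \<forall>D\<in>#fam s. owner D = i \<longrightarrow> verts C \<subseteq> verts D)
   | Merge \<Rightarrow> owners_in (pending s) (fam s) \<and> edges_ok (result s) (fam s))"

definition invar :: "('i, 'v) state \<Rightarrow> bool" where
  "invar s \<longleftrightarrow> family_ok (fam s) \<and> meta_ok (fam s) (meta s) \<and> result_ok (pending s) (result s) \<and>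
     (\<forall>j\<in>pending s. owner_mass j (fam s) = 1) \<and> phase_ok s"

section \<open>Terminals, edges and loads\<close>

lemma finite_terminals: "finite terminals"
proof -
  have "finite (S a)" if "a \<in> {1..k}" for a
    using two_terminals[OF that] card.infinite by fastforce
  then show ?thesis unfolding terminals_def by auto
qed

lemma terminal_in_V: "i \<in> terminals \<Longrightarrow> r i \<in> V"
  using residence unfolding terminals_def by auto

lemma edge_distinct: "{u, v} \<in> E \<Longrightarrow> u \<noteq> v \<and> u \<in> V \<and> v \<in> V"
  using edges[of "{u, v}"] by auto

lemma boundary_iff:
  assumes "{u, v} \<in> E"
  shows "{u, v} \<in> boundary E A \<longleftrightarrow> (u \<in> A) \<noteq> (v \<in> A)"
proof -
  have "u \<noteq> v" using edge_distinct[OF assms] by simp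
  then show ?thesis using assms
    by (cases "u \<in> A"; cases "v \<in> A") (auto simp: boundary_def Int_insert_left)
qed

lemma load_eq_sides:
  assumes "{u, v} \<in> E"
  shows "load E F {u, v} = side u v F + side v u F"
  using boundary_iff[OF assms] by (induction F) (auto simp: load_def)

lemma meta_okD:
  assumes "meta_ok F M"
  shows "v \<in> M v" and "u \<in> M v \<Longrightarrow> M u = M v" and "v \<in> V \<Longrightarrow> M v \<subseteq> V"
    and "u \<in> M v \<Longrightarrow> C \<in># F \<Longrightarrow> 0 < wt C \<Longrightarrow> u \<in> verts C \<longleftrightarrow> v \<in> verts C"
  using assms by (simp_all add: meta_ok_def)

section \<open>Stability of the invariants under splitting of cuts\<close>

lemma meta_ok_refines:
  assumes M: "meta_ok F M" and "refines G F"
  shows "meta_ok G M"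
proof -
  have "u \<in> verts D \<longleftrightarrow> v \<in> verts D" if D: "D \<in># G" "u \<in> M v" "0 < wt D" for u v D
  proof -
    obtain C where C: "C \<in># F" "verts D = verts C" "wt D \<le> wt C"
      using refinesE[OF assms(2) D(1)] by metis
    then have "0 < wt C" using D(3) by linarith
    then show ?thesis using meta_okD(4)[OF M D(2) C(1)] C(2) by simp
  qed
  then show ?thesis using M unfolding meta_ok_def by simp
qed

lemma family_ok_refines:
  assumes "family_ok F" "refines G F"
  shows "family_ok G"
  unfolding family_ok_def
proof (intro conjI ballI)
  show "nonneg G" using assms(2) by (rule refines_nonneg)
next
  fix C D assume "C \<in># G" "D \<in># G"
  then show "\<not> crossing (verts C) (verts D)"
    using assms by (metis refinesE family_ok_def)
next
  fix C assume "C \<in># G"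
  then show "r (owner C) \<in> verts C" "t \<notin> verts C"
    using assms by (metis refinesE family_ok_def)+
qed

lemma owners_in_refines:
  assumes own: "owners_in T' F" and "refines G F"
  shows "owners_in T' G"
  unfolding owners_in_def
proof (intro ballI impI)
  fix D assume D: "D \<in># G" "0 < wt D"
  then obtain C where C: "C \<in># F" "owner D = owner C" "wt D \<le> wt C"
    using refinesE[OF assms(2)] by metis
  then have "0 < wt C" using D(2) by linarith
  then show "owner D \<in> T'" using own C by (simp add: owners_in_def)
qed

lemma chain_at:
  assumes "family_ok F" "C \<in># F" "D \<in># F" "v \<in> verts C" "v \<in> verts D"
  shows "verts C \<subseteq> verts D \<or> verts D \<subseteq> verts C"
  using assms unfolding family_ok_def crossing_def by blast

text \<open>
  A minimal cut containing \<open>v\<close> but not \<open>u\<close> lies in every cut that contains \<open>v\<close>, hence its owner is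
  at least as deep as \<open>v\<close>.
\<close>

lemma deepest_side_le:
  assumes F: "family_ok F" and M: "meta_ok F M" and own: "owners_in T' F"
    and deepest: "\<forall>j\<in>T'. depth F (r j) \<le> depth F (r i)" and u: "u \<in> M (r i)"
  shows "side v u F \<le> side u v F"
proof (cases "side v u F = 0")
  case True
  then show ?thesis using F mass_nonneg by (auto simp: family_ok_def)
next
  case False
  have nn: "nonneg F" using F by (simp add: family_ok_def)
  define X where "X = {C \<in> set_mset F. 0 < wt C \<and> v \<in> verts C \<and> u \<notin> verts C}"
  have "verts ` X \<noteq> {}" using False mass_eq_0_iff[OF nn] unfolding X_def by fastforce
  moreover have "finite (verts ` X)" unfolding X_def by simp
  ultimately obtain A where A: "A \<in> verts ` X" "\<And>B. B \<in> verts ` X \<Longrightarrow> B \<subseteq> A \<Longrightarrow> B = A"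
    using finite_has_minimal[of "verts ` X"] by metis
  then obtain C where C: "C \<in># F" "0 < wt C" "v \<in> verts C" "u \<notin> verts C" "A = verts C"
    unfolding X_def by auto
  have "verts C \<subseteq> verts D" if D: "D \<in># F" "0 < wt D" "v \<in> verts D" for D
  proof (rule ccontr)
    assume *: "\<not> verts C \<subseteq> verts D"
    then have "verts D \<subseteq> verts C" using chain_at[OF F C(1) D(1) C(3) D(3)] by blast
    moreover have "D \<in> X" using D C(4) calculation unfolding X_def by blast
    ultimately show False using A(2)[of "verts D"] C(5) * by auto
  qed
  then have "mass (\<lambda>_ A. v \<in> A) F \<le> mass (\<lambda>_ A. r (owner C) \<in> A) F"
    using F C(1) by (intro mass_mono[OF nn]) (auto simp: family_ok_def)
  also have "\<dots> \<le> depth F (r i)"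
    using deepest own C unfolding owners_in_def depth_eq_mass by blast
  \<comment> \<open>\<open>u\<close> and \<open>r i\<close> share a meta-node, hence the same cuts
    of positive weight contain them.\<close>
  also have "\<dots> = mass (\<lambda>_ A. u \<in> A) F"
    unfolding depth_eq_mass using meta_okD(4)[OF M u] by (intro mass_cong[OF nn]) auto
  finally have "mass (\<lambda>_ A. v \<in> A) F \<le> mass (\<lambda>_ A. u \<in> A) F" .
  moreover have "mass (\<lambda>_ A. v \<in> A) F = mass (\<lambda>_ A. u \<in> A \<and> v \<in> A) F + side v u F"
    using mass_split[of "\<lambda>_ A. v \<in> A" F "\<lambda>_ A. u \<in> A"] by (simp add: conj_commute)
  moreover have "mass (\<lambda>_ A. u \<in> A) F = mass (\<lambda>_ A. u \<in> A \<and> v \<in> A) F + side u v F"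
    using mass_split[of "\<lambda>_ A. u \<in> A" F "\<lambda>_ A. v \<in> A"] by simp
  ultimately show ?thesis by linarith
qed

text \<open>At load 0 no cut of positive weight separates \<open>u\<close> from \<open>v\<close>, so
  the two united classes lie on the same side of each such cut.\<close>

lemma merge_nodes_ok:
  assumes M: "meta_ok F M" and nn: "nonneg F" and e: "{u, v} \<in> E" and load: "load E F {u, v} = 0"
  shows "meta_ok F (merge_nodes M u v)"
proof -
  have refl: "x \<in> M x" and eq: "x \<in> M y \<Longrightarrow> M x = M y"
    and agree: "x \<in> M y \<Longrightarrow> C \<in># F \<Longrightarrow> 0 < wt C \<Longrightarrow> x \<in> verts C \<longleftrightarrow> y \<in> verts C" for x y C
    by (fact meta_okD[OF M])+
  have uv: "u \<in> verts C \<longleftrightarrow> v \<in> verts C" if "C \<in># F" "0 < wt C" for C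
    using that load nn mass_eq_0_iff[OF nn] mass_nonneg[OF nn]
    unfolding load_eq_sides[OF e] by (metis (no_types, lifting) add_nonneg_eq_0_iff)
  show ?thesis unfolding meta_ok_def
  proof (intro conjI allI ballI impI)
    show "x \<in> merge_nodes M u v x" for x using refl by (simp add: merge_nodes_def)
  next
    fix x y assume xy: "x \<in> merge_nodes M u v y"
    show "merge_nodes M u v x = merge_nodes M u v y"
    proof (cases "y \<in> M u \<union> M v")
      case False
      then have "M x = M y" "x \<in> M y" using xy eq by (auto simp: merge_nodes_def)
      then have "x \<notin> M u \<union> M v" using False refl[of y] eq by blast
      then show ?thesis using False \<open>M x = M y\<close> by (simp add: merge_nodes_def)
    qed (use xy in \<open>auto simp: merge_nodes_def\<close>)
    fix C assume "C \<in># F" "0 < wt C"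
    then show "x \<in> verts C \<longleftrightarrow> y \<in> verts C"
      using xy uv agree by (simp add: merge_nodes_def split: if_splits) blast
  next
    have "u \<in> V" "v \<in> V" using edge_distinct[OF e] by auto
    then show "merge_nodes M u v x \<subseteq> V" if "x \<in> V" for x
      using that meta_okD(3)[OF M] by (simp add: merge_nodes_def)
  qed
qed

section \<open>The effect of a new output cut on the edges\<close>

lemma crossings_update:
  assumes "finite (dom \<A>)" "i \<notin> dom \<A>"
  shows "crossings (\<A>(i \<mapsto> B)) e = (if e \<in> boundary E B then Suc (crossings \<A> e) else crossings \<A> e)"
proof -
  let ?X = "{j \<in> dom \<A>. e \<in> boundary E (the (\<A> j))}"
  have "{j \<in> dom (\<A>(i \<mapsto> B)). e \<in> boundary E (the ((\<A>(i \<mapsto> B)) j))} =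
    (if e \<in> boundary E B then insert i ?X else ?X)"
    using assms(2) by auto
  then show ?thesis using assms unfolding crossings_def by auto
qed

lemma edges_ok_cong:
  assumes "\<And>u v. side u v F = side u v G"
  shows "edges_ok \<A> F \<longleftrightarrow> edges_ok \<A> G"
  unfolding edges_ok_def using assms by simp

text \<open>Only edges leaving \<open>M (r i)\<close> are crossed once more. If such an edge carries
  load, \<open>edge_bound_cut\<close> applies with \<open>q\<close> the weight of \<open>K\<close>
  on its inner side. On all other edges neither side grows.\<close>

lemma edges_ok_select:
  assumes F: "family_ok F" and M: "meta_ok F M" and own: "owners_in T' F"
    and deepest: "\<forall>j\<in>T'. depth F (r j) \<le> depth F (r i)"
    and inner: "innermost 1 (cuts_at F (r i)) K R"
    and ok: "edges_ok \<A> F"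
    and merged: "\<A> = Map.empty \<or> (\<forall>u v. {u, v} \<in> E \<and> load E F {u, v} = 0 \<longrightarrow> M u = M v)"
    and \<A>: "finite (dom \<A>)" "i \<notin> dom \<A>"
  shows "edges_ok (\<A>(i \<mapsto> M (r i))) (F - cuts_at F (r i) + R)"
proof -
  define L where "L = cuts_at F (r i)"
  define G where "G = F - L + R"
  have nn: "nonneg F" using F by (simp add: family_ok_def)
  have LF: "L \<subseteq># F" by (simp add: L_def cuts_at_def)
  have nnL: "nonneg L" using nonneg_sub[OF nn LF] .
  note split = innermost_split[OF inner[folded L_def] nnL]
  have nnK: "nonneg K" and nnR: "nonneg R" using split(3,4) refines_nonneg by auto
  have massG: "mass Q G = mass Q F - mass Q K" for Q
    using split(1)[of Q] mass_diff[OF LF, of Q] by (simp add: G_def)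
  have G_le: "mass Q G \<le> mass Q F" for Q using massG mass_nonneg[OF nnK] by simp
  have nnG: "nonneg G"
    using nonneg_sub[OF nn diff_subset_eq_self, of L] nnR by (auto simp: nonneg_def G_def)
  have in_L: "r i \<in> verts C \<and> (\<exists>D\<in>#F. verts C = verts D \<and> wt C \<le> wt D)"
    if C: "C \<in># K \<or> C \<in># R" for C
  proof -
    have "C \<in># K + R" using C by simp
    then obtain D where "D \<in># L" "verts C = verts D" "wt C \<le> wt D"
      using refinesE[OF refines_add[OF split(3,4)]] by metis
    then show ?thesis by (auto simp: L_def cuts_at_def)
  qed
  have node: "u \<in> verts C" if C: "C \<in># K \<or> C \<in># R" "0 < wt C" "u \<in> M (r i)" for C u
  proof -
    obtain D where D: "D \<in># F" "verts C = verts D" "wt C \<le> wt D" using in_L[OF C(1)] by blast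
    then have "0 < wt D" using C(2) by linarith
    then have "u \<in> verts D \<longleftrightarrow> r i \<in> verts D" by (rule meta_okD(4)[OF M C(3) D(1)])
    then show ?thesis using D(2) in_L[OF C(1)] by simp
  qed
  have cut: "edge_bound (c {u, v}) (Suc (crossings \<A> {u, v})) (side u v G) (side v u G)"
    if e: "{u, v} \<in> E" and u: "u \<in> M (r i)" and v: "v \<notin> M (r i)" for u v
  proof (cases "side u v F + side v u F = 0")
    case True
    \<comment> \<open>An edge of load 0 between different meta-nodes exists at a selection only in
      the first iteration. Its count then becomes 1, and the third disjunct holds.\<close>
    have "M u \<noteq> M v" using meta_okD(1)[OF M, of v] meta_okD(2)[OF M u] v by auto
    moreover have "load E F {u, v} = 0" using True load_eq_sides[OF e, of F] by simp
    ultimately have "\<A> = Map.empty" using merged e by blast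
    moreover have "side u v G = 0" "side v u G = 0"
      using True mass_nonneg[OF nn] mass_nonneg[OF nnG] G_le
      by (smt (verit, best))+
    ultimately show ?thesis by (simp add: edge_bound_def crossings_def)
  next
    case False
    \<comment> \<open>Cuts of positive weight in \<open>K\<close> contain the whole meta-node of
      \<open>r i\<close>, hence \<open>u\<close>.\<close>
    have "side v u K = 0" using node u by (auto simp: mass_eq_0_iff[OF nnK])
    then have vu: "side v u G = side v u F" using massG by simp
    \<comment> \<open>If some cut of positive weight in \<open>R\<close> contains only
      \<open>u\<close>, all cuts of \<open>K\<close> lie inside it and miss \<open>v\<close>, so the
      whole weight 1 of \<open>K\<close> is on this side. Otherwise all the weight on this side
      belongs to \<open>K\<close>.\<close>
    have "side u v G = 0 \<or> side u v K = 1"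
    proof (cases "side u v R = 0")
      case True
      then have "side u v K = side u v L" using split(1)[of "\<lambda>_ A. u \<in> A \<and> v \<notin> A"] by simp
      moreover have "side u v L = side u v F"
        unfolding L_def cuts_at_def mass_filter[of _ "\<lambda>_ A. r i \<in> A"]
        using meta_okD(4)[OF M u] by (intro mass_cong[OF nn]) auto
      ultimately show ?thesis using massG by simp
    next
      case False
      then obtain D where "D \<in># R" "v \<notin> verts D" by (auto simp: mass_eq_0_iff[OF nnR])
      then have "v \<notin> verts C" if "C \<in># K" for C using split(5) that by blast
      then have "side u v K = weight K"
        unfolding weight_eq_mass using node u by (intro mass_cong[OF nnK]) auto
      then show ?thesis using split(2) by simp
    qed
    moreover have "side u v F = side u v K + side u v G" using massG by simp
    moreover have "side u v K \<le> 1" using mass_le_weight[OF nnK] split(2) by metis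
    moreover have "side v u F \<le> side u v F" by (rule deepest_side_le[OF F M own deepest u])
    moreover have "0 \<le> side v u F" "0 \<le> side u v F" by (intro mass_nonneg nn)+
    then have "0 < side u v F + side v u F" using False by linarith
    moreover have "edge_bound (c {u, v}) (crossings \<A> {u, v}) (side u v F) (side v u F)"
      using ok e by (simp add: edges_ok_def)
    ultimately show ?thesis
      unfolding vu using mass_nonneg[OF nnG] mass_nonneg[OF nnK] mass_nonneg[OF nn]
      by (intro edge_bound_cut[where q = "side u v K"]) auto
  qed
  have "edges_ok (\<A>(i \<mapsto> M (r i))) G"
    unfolding edges_ok_def
  proof (intro allI impI)
    fix u v assume e: "{u, v} \<in> E"
    then have e': "{v, u} \<in> E" "{v, u} = {u, v}" by (simp_all add: insert_commute)
    show "edge_bound (c {u, v}) (crossings (\<A>(i \<mapsto> M (r i))) {u, v}) (side u v G) (side v u G)"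
    proof (cases "{u, v} \<in> boundary E (M (r i))")
      case True
      then consider "u \<in> M (r i)" "v \<notin> M (r i)" | "v \<in> M (r i)" "u \<notin> M (r i)"
        using boundary_iff[OF e] by blast
      then have "edge_bound (c {u, v}) (Suc (crossings \<A> {u, v})) (side u v G) (side v u G)"
      proof cases
        case 1
        then show ?thesis by (rule cut[OF e])
      next
        case 2
        then show ?thesis
          using cut[OF e'(1), unfolded e'(2)] by (subst edge_bound_commute)
      qed
      then show ?thesis using True crossings_update[OF \<A>] by simp
    next
      case False
      have "edge_bound (c {u, v}) (crossings \<A> {u, v}) (side u v F) (side v u F)"
        using ok e by (simp add: edges_ok_def)
      then have "edge_bound (c {u, v}) (crossings \<A> {u, v}) (side u v G) (side v u G)"
        by (rule edge_bound_mono) (intro mass_nonneg nnG G_le)+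
      then show ?thesis using False crossings_update[OF \<A>] by simp
    qed
  qed
  then show ?thesis by (simp add: G_def L_def)
qed

section \<open>Preservation of the invariant\<close>

lemma owner_mass_eq_weight: "owner_mass i F = weight (owned F i)"
  by (simp add: mass_def owned_def)

lemma mass_no_owner: "(\<And>C. C \<in># F \<Longrightarrow> owner C \<noteq> i) \<Longrightarrow> owner_mass i F = 0"
  by (induction F) auto

lemma owned_chain:
  assumes "family_ok F" "C \<in># owned F i" "D \<in># owned F i"
  shows "verts C \<subseteq> verts D \<or> verts D \<subseteq> verts C"
proof (rule chain_at[OF assms(1)])
  show "C \<in># F" "D \<in># F" "r i \<in> verts C" "r i \<in> verts D"
    using assms by (auto simp: owned_def family_ok_def)
qed

lemma invar_select:
  assumes inv: "invar \<lparr>pending = T', result = \<A>, fam = F, meta = M, phase = Select\<rparr>"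
    and i: "i \<in> T'" and deepest: "\<forall>j\<in>T'. depth F (r j) \<le> depth F (r i)"
    and inner: "innermost 1 (cuts_at F (r i)) K R" and K': "K' = K - owned K i"
  shows "invar \<lparr>pending = T' - {i}, result = \<A>(i \<mapsto> M (r i)),
    fam = F - cuts_at F (r i) + R + K', meta = M, phase = Reassign i K'\<rparr>"
proof -
  define L where "L = cuts_at F (r i)"
  define F' where "F' = F - L + R + K'"
  have F: "family_ok F" and M: "meta_ok F M" and res: "result_ok T' \<A>"
    and one: "\<And>j. j \<in> T' \<Longrightarrow> owner_mass j F = 1"
    and own: "owners_in T' F" and edges: "edges_ok \<A> F"
    and merged: "\<A> = Map.empty \<or> (\<forall>u v. {u, v} \<in> E \<and> load E F {u, v} = 0 \<longrightarrow> M u = M v)"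
    using inv by (auto simp: invar_def phase_ok_def)
  have nn: "nonneg F" using F by (simp add: family_ok_def)
  have LF: "L \<subseteq># F" by (simp add: L_def cuts_at_def)
  note split = innermost_split[OF inner[folded L_def] nonneg_sub[OF nn LF]]
  have nnK: "nonneg K" using split(3) by (rule refines_nonneg)
  have K'_filter: "K' = filter_mset (\<lambda>C. owner C \<noteq> i) K"
    unfolding K' owned_def by (rule diff_filter_mset)
  have massK': "mass Q K' = mass (\<lambda>j A. j \<noteq> i \<and> Q j A) K" for Q
    unfolding K'_filter by (rule mass_filter)
  have massF': "mass Q F' = mass Q F - mass Q K + mass Q K'" for Q
    using split(1)[of Q] mass_diff[OF LF, of Q] by (simp add: F'_def)
  have "refines L F" using nn LF by (rule refines_sub)
  moreover have "refines K' K" using nnK by (rule refines_sub) (simp add: K')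
  moreover have "refines (F - L) F" using nn by (rule refines_sub) simp
  ultimately have ref: "refines F' F"
    unfolding F'_def using split(3,4) refines_add refines_trans by metis
  have i_term: "i \<in> terminals" and dom: "dom \<A> = terminals - T'"
    using res i by (auto simp: result_ok_def)
  then have fin: "finite (dom \<A>)" "i \<notin> dom \<A>" using finite_terminals i by auto
  have "r i \<in> V" using i_term by (rule terminal_in_V)
  \<comment> \<open>Being pending, \<open>i\<close> owns a cut of positive weight. It contains
    \<open>r i\<close>, misses \<open>t\<close> and splits no meta-node, so \<open>t\<close> is not
    in \<open>M (r i)\<close>.\<close>
  have "owner_mass i F \<noteq> 0" using one[OF i] by simp
  then obtain C where C: "C \<in># F" "0 < wt C" "owner C = i"
    using mass_eq_0_iff[OF nn] by blast
  then have "r i \<in> verts C" "t \<notin> verts C" using F by (auto simp: family_ok_def)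
  then have t: "t \<notin> M (r i)" using meta_okD(4)[OF M _ C(1,2)] by blast
  have cut: "is_cut V (M (r i))" "r i \<in> M (r i)"
    using t meta_okD(1,3)[OF M] \<open>r i \<in> V\<close> sink unfolding is_cut_def by blast+
  have "result_ok (T' - {i}) (\<A>(i \<mapsto> M (r i)))"
    using res i i_term t cut unfolding result_ok_def by auto
  moreover have "owner_mass j F' = 1" if "j \<in> T' - {i}" for j
  proof -
    have "owner_mass j K' = owner_mass j K"
      unfolding massK' using that by (intro mass_cong[OF nnK]) auto
    then show ?thesis using massF' one that by simp
  qed
  \<comment> \<open>Both \<open>K\<close> and the cuts of \<open>i\<close> in \<open>F\<close> weigh
    1. Taking away what they share leaves equal weights.\<close>
  moreover have "owner_mass i F' = weight K'"
  proof -
    have "weight K = owner_mass i K + weight K'"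
      using mass_split[of "\<lambda>_ _. True" K "\<lambda>j _. j = i"] massK'[of "\<lambda>_ _. True"]
      by (simp add: weight_eq_mass)
    moreover have "owner_mass i K' = 0" by (rule mass_no_owner) (simp add: K'_filter)
    ultimately show ?thesis using massF' one[OF i] split(2) by simp
  qed
  moreover have "verts C \<subseteq> verts D" if "C \<in># K'" "D \<in># F'" "owner D = i" for C D
  proof -
    \<comment> \<open>All cuts of \<open>i\<close> contain \<open>r i\<close>, so what
      \<open>i\<close> still owns lies in \<open>R\<close>, around every cut of
      \<open>K\<close>.\<close>
    have "D \<notin># F - L"
    proof
      assume "D \<in># F - L"
      moreover have "F - L = filter_mset (\<lambda>C. r i \<notin> verts C) F"
        unfolding L_def cuts_at_def by (rule diff_filter_mset)
      ultimately show False using F \<open>owner D = i\<close> by (auto simp: family_ok_def)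
    qed
    then have "D \<in># R" using that by (auto simp: F'_def K'_filter)
    moreover have "C \<in># K" using that by (simp add: K'_filter)
    ultimately show ?thesis by (intro split(5))
  qed
  moreover have "edges_ok (\<A>(i \<mapsto> M (r i))) (F' - K')"
    using edges_ok_select[OF F M own deepest inner edges merged fin] by (simp add: F'_def L_def)
  moreover have "owners_in (insert i (T' - {i})) F'"
    using owners_in_refines[OF own ref] i by (simp add: insert_absorb)
  moreover have "K' \<subseteq># F'" by (simp add: F'_def)
  moreover have "\<forall>C\<in>#K'. owner C \<noteq> i" by (simp add: K'_filter)
  ultimately have "invar \<lparr>pending = T' - {i}, result = \<A>(i \<mapsto> M (r i)), fam = F', meta = M,
    phase = Reassign i K'\<rparr>"
    using family_ok_refines[OF F ref] meta_ok_refines[OF M ref]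
    unfolding invar_def phase_ok_def by simp
  then show ?thesis by (simp add: F'_def L_def)
qed

text \<open>The cut \<open>C\<close> of \<open>j\<close> is traded for cuts of \<open>i\<close> of
  the same weight. These contain \<open>C\<close>, hence \<open>r j\<close>, so \<open>j\<close> may
  own them. The weight of \<open>K\<close> and the weight owned by \<open>i\<close> both drop by
  \<open>wt C\<close>.\<close>

lemma invar_reassign:
  assumes inv: "invar \<lparr>pending = T', result = \<A>, fam = F, meta = M, phase = Reassign i K\<rparr>"
    and C: "C \<in># K" and j: "owner C = j" "j \<in> T'"
    and inner: "innermost (wt C) (owned F i) P R"
  shows "invar \<lparr>pending = T', result = \<A>,
    fam = F - {#C#} - owned F i + R + image_mset (\<lambda>D. D\<lparr>owner := j\<rparr>) P,
    meta = M, phase = Reassign i (K - {#C#})\<rparr>"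
proof -
  define L where "L = owned F i"
  define G where "G = F - {#C#} - L"
  define P' where "P' = image_mset (\<lambda>D. D\<lparr>owner := j\<rparr>) P"
  define F' where "F' = G + R + P'"
  have F: "family_ok F" and M: "meta_ok F M" and res: "result_ok T' \<A>"
    and one: "\<And>j. j \<in> T' \<Longrightarrow> owner_mass j F = 1"
    and own: "owners_in (insert i T') F" and edges: "edges_ok \<A> (F - K)" and KF: "K \<subseteq># F"
    and i: "i \<notin> T'" "\<And>C. C \<in># K \<Longrightarrow> owner C \<noteq> i" and mass_i: "owner_mass i F = weight K"
    and below: "\<And>C D. C \<in># K \<Longrightarrow> D \<in># F \<Longrightarrow> owner D = i \<Longrightarrow> verts C \<subseteq> verts D"
    using inv by (auto simp: invar_def phase_ok_def)
  have nn: "nonneg F" using F by (simp add: family_ok_def)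
  have LF: "L \<subseteq># F" by (simp add: L_def owned_def)
  note split = innermost_split[OF inner[folded L_def] nonneg_sub[OF nn LF]]
  have CF: "C \<in># F" using KF C by (rule mset_subset_eqD)
  have ji: "j \<noteq> i" using i(1) j by auto
  have LFC: "L \<subseteq># F - {#C#}"
    unfolding subseteq_mset_def L_def owned_def using j ji by auto
  have massF': "mass Q F' = mass Q F - (if Q j (verts C) then wt C else 0) - mass Q L + mass Q R +
    mass (\<lambda>_. Q j) P" for Q
    using mass_diff[OF LFC, of Q] mass_diff[of "{#C#}" F Q] CF j
    by (simp add: F'_def G_def P'_def mass_set_owner)
  have R_owner: "owner D = i" if "D \<in># R" for D
    using refinesE[OF split(4) that] by (auto simp: L_def owned_def)
  have P_below: "verts C \<subseteq> verts D" if "D \<in># P" for D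
    using refinesE[OF split(3) that] below[OF C] by (auto simp: L_def owned_def)
  have GF: "G \<subseteq># F" unfolding G_def by (metis diff_subset_eq_self subset_mset.order_trans)
  have "refines (G + R + P) F"
    using refines_sub[OF nn GF] refines_trans[OF split(3) refines_sub[OF nn LF]]
      refines_trans[OF split(4) refines_sub[OF nn LF]] by (intro refines_add)
  note ref = family_ok_refines[OF F this] meta_ok_refines[OF M this] owners_in_refines[OF own this]
  \<comment> \<open>Reassignment changes owners only: vertex sets and weights come from
    \<open>G + R + P\<close>, and residence has to be checked afresh only for the new owner
    \<open>j\<close>.\<close>
  have F'_cases: "(\<exists>D0\<in>#G + R + P. verts D = verts D0 \<and> wt D = wt D0) \<and>
      (D \<in># G + R \<or> owner D = j \<and> r j \<in> verts D)" if D: "D \<in># F'" for D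
  proof (cases "D \<in># P'")
    case True
    then obtain D0 where D0: "D0 \<in># P" "D = D0\<lparr>owner := j\<rparr>" by (auto simp: P'_def)
    have "r j \<in> verts C" using F CF j by (auto simp: family_ok_def)
    then show ?thesis using D0 P_below[OF D0(1)] by auto
  next
    case False
    then show ?thesis using D by (auto simp: F'_def)
  qed
  have "family_ok F'"
    unfolding family_ok_def nonneg_def
  proof (intro conjI ballI)
    fix D assume D: "D \<in># F'"
    then show "0 \<le> wt D" "t \<notin> verts D"
      using F'_cases[OF D] ref(1) by (auto simp: family_ok_def nonneg_def)
    show "r (owner D) \<in> verts D"
      using F'_cases[OF D] ref(1) by (auto simp: family_ok_def)
    fix D' assume D': "D' \<in># F'"
    show "\<not> crossing (verts D) (verts D')"
      using F'_cases[OF D] F'_cases[OF D'] ref(1) unfolding family_ok_def by metis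
  qed
  moreover have "meta_ok F' M"
    using F'_cases ref(2) unfolding meta_ok_def by metis
  \<comment> \<open>For \<open>j\<close> itself the loss of \<open>C\<close> is made up by
    \<open>P\<close>, which weighs \<open>wt C\<close>.\<close>
  moreover have "owner_mass j' F' = 1" if "j' \<in> T'" for j'
  proof -
    have "j' \<noteq> i" using that i by auto
    then have "owner_mass j' L = 0" "owner_mass j' R = 0"
      using R_owner by (intro mass_no_owner; auto simp: L_def owned_def)+
    then show ?thesis
      using massF'[of "\<lambda>i _. i = j'"] one[OF that] split(2)
      by (auto simp: weight_eq_mass)
  qed
  moreover have "owner_mass i F' = weight (K - {#C#})"
  proof -
    have "weight K = wt C + weight (K - {#C#})"
      using C by (metis insert_DiffM weight_simps(2))
    moreover have "owner_mass i P + owner_mass i R = owner_mass i L" by (rule split(1))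
    moreover have "owner_mass i P = wt C"
    proof -
      have "owner D = i" if "D \<in># P" for D
        using refinesE[OF split(3) that] by (auto simp: L_def owned_def)
      then have "filter_mset (\<lambda>D. owner D = i) P = P" by (simp add: filter_mset_eq_conv)
      then show ?thesis using split(2) by (simp add: mass_def)
    qed
    ultimately show ?thesis using massF'[of "\<lambda>j _. j = i"] mass_i ji by simp
  qed
  moreover have "verts C' \<subseteq> verts D" if "C' \<in># K - {#C#}" "D \<in># F'" "owner D = i" for C' D
  proof -
    have "D \<notin># G" using that(3) by (auto simp: G_def L_def owned_def in_diff_count)
    moreover have "D \<notin># P'" using that(3) ji by (auto simp: P'_def)
    ultimately have "D \<in># R" using that(2) by (simp add: F'_def)
    then obtain D0 where "D0 \<in># F" "owner D0 = i" "verts D = verts D0"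
      using refinesE[OF split(4)] by (metis (mono_tags, lifting) L_def R_owner LF mset_subset_eqD)
    then show ?thesis using below[OF in_diffD[OF that(1)]] by simp
  qed
  moreover have KG: "K - {#C#} \<subseteq># G"
    unfolding subseteq_mset_def
  proof
    fix D
    have "count K D \<le> count F D" using KF by (simp add: subseteq_mset_def)
    moreover have "count K D = 0" if "owner D = i" using that i(2) count_eq_zero_iff by metis
    ultimately show "count (K - {#C#}) D \<le> count G D"
      by (auto simp: G_def L_def owned_def)
  qed
  moreover have "edges_ok \<A> (F' - (K - {#C#}))"
  proof -
    have KF': "K - {#C#} \<subseteq># F'" using KG unfolding F'_def by (simp add: subset_mset.add_increasing2)
    \<comment> \<open>\<open>P\<close> and \<open>R\<close> together weigh as much as
      \<open>L\<close> on each side, and \<open>C\<close> leaves both the family and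
      \<open>K\<close>.\<close>
    have "side u v (F' - (K - {#C#})) = side u v (F - K)" for u v
      using mass_diff[OF KF'] mass_diff[OF KF] mass_diff[of "{#C#}" K] C massF'
        split(1)[of "\<lambda>_ A. u \<in> A \<and> v \<notin> A"]
      by simp
    then show ?thesis using edges edges_ok_cong by blast
  qed
  moreover have "owners_in (insert i T') F'"
    using F'_cases ref(3) j(2) unfolding owners_in_def by fastforce
  moreover have "K - {#C#} \<subseteq># F'"
    using KG unfolding F'_def by (simp add: subset_mset.add_increasing2)
  moreover have "\<forall>C'\<in>#K - {#C#}. owner C' \<noteq> i" using i(2) by (auto dest: in_diffD)
  ultimately have "invar \<lparr>pending = T', result = \<A>, fam = F', meta = M,
    phase = Reassign i (K - {#C#})\<rparr>"
    using res i(1) unfolding invar_def phase_ok_def by simp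
  then show ?thesis by (simp add: F'_def G_def L_def P'_def)
qed

text \<open>
  The weight that is still owned by \<open>i\<close> equals the weight of \<open>K\<close>. A cut left in \<open>K\<close> has no pending
  owner, hence has weight 0.
\<close>

lemma invar_reassign_done:
  assumes inv: "invar \<lparr>pending = T', result = \<A>, fam = F, meta = M, phase = Reassign i K\<rparr>"
    and stuck: "\<forall>C\<in>#K. owner C \<notin> T'"
  shows "invar \<lparr>pending = T', result = \<A>, fam = F, meta = M, phase = Merge\<rparr>"
proof -
  have F: "family_ok F" and own: "owners_in (insert i T') F" and edges: "edges_ok \<A> (F - K)"
    and KF: "K \<subseteq># F" and i: "\<And>C. C \<in># K \<Longrightarrow> owner C \<noteq> i"
    and mass_i: "owner_mass i F = weight K"
    using inv by (auto simp: invar_def phase_ok_def)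
  have nn: "nonneg F" using F by (simp add: family_ok_def)
  have nnK: "nonneg K" using nn KF by (rule nonneg_sub)
  have zero: "\<not> 0 < wt C" if "C \<in># K" for C
    using own stuck i[OF that] mset_subset_eqD[OF KF that] that unfolding owners_in_def by blast
  then have massK: "mass Q K = 0" for Q by (simp add: mass_eq_0_iff[OF nnK])
  then have "owner_mass i F = 0" using mass_i by (simp add: weight_eq_mass)
  then have "owners_in T' F"
    using own unfolding owners_in_def mass_eq_0_iff[OF nn] by auto
  moreover have "edges_ok \<A> F"
    using edges edges_ok_cong[of "F - K" F] mass_diff[OF KF] massK by simp
  ultimately show ?thesis using inv by (simp add: invar_def phase_ok_def)
qed

lemma invar_step:
  assumes "round1_step E r s s'" "invar s"
  shows "invar s'"
  using assms
proof cases
  case (select i T' F K R K' \<A> M)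
  then show ?thesis using assms(2) invar_select by metis
next
  case (reassign C K j T' F i P R \<A> M)
  then show ?thesis using assms(2) invar_reassign by metis
next
  case (reassign_done K T' \<A> F M i)
  then show ?thesis using assms(2) invar_reassign_done by metis
next
  case (merge u v F M T' \<A>)
  have "meta_ok F M" "nonneg F" using assms(2) merge by (auto simp: invar_def family_ok_def)
  then have "meta_ok F (merge_nodes M u v)" using merge(3,4) by (rule merge_nodes_ok)
  then show ?thesis using assms(2) merge by (simp add: invar_def phase_ok_def)
next
  case (merge_done F M T' \<A>)
  then show ?thesis using assms(2) by (simp add: invar_def phase_ok_def)
qed

lemma invar_init:
  assumes "fractional_laminar_family V r T F" "fractional_feasible E t k S r c T F"
  shows "invar (round1_init T F)" and "T = terminals"
proof -
  show T: "T = terminals" using assms(2) by (simp add: fractional_feasible_def terminals_def)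
  have F: "family_ok F" "owners_in T F" "\<forall>j\<in>T. owner_mass j F = 1"
    using assms unfolding family_ok_def owners_in_def nonneg_def fractional_laminar_family_def
      fractional_feasible_def owner_mass_eq_weight by auto
  moreover have "meta_ok F (\<lambda>v. {v})" by (simp add: meta_ok_def)
  moreover have "result_ok T Map.empty" by (simp add: result_ok_def T)
  \<comment> \<open>With no output cut yet, the capacity constraint is the first disjunct of
    \<open>edge_bound\<close>.\<close>
  moreover have "side u v F + side v u F \<le> real (c {u, v})" if "{u, v} \<in> E" for u v
    using assms(2) load_eq_sides[OF that, of F] that by (auto simp: fractional_feasible_def)
  then have "edges_ok Map.empty F"
    by (simp add: edges_ok_def edge_bound_def crossings_def)
  ultimately show "invar (round1_init T F)"
    by (simp add: invar_def phase_ok_def round1_init_def)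
qed

section \<open>Termination and progress\<close>

text \<open>Selecting lowers the first component. Within one iteration the phases descend from 2 to
  0, each exchange shrinks \<open>K\<close>, and each merge lowers the number of meta-nodes.\<close>

definition rank :: "('i, 'v) state \<Rightarrow> nat \<times> nat \<times> nat" where
  "rank s = (card (pending s), case phase s of
     Reassign i K \<Rightarrow> (2, size K) | Merge \<Rightarrow> (1, card (meta s ` V)) | Select \<Rightarrow> (0, 0))"

text \<open>Merging acts on the meta-nodes through a map that identifies \<open>M u\<close> with
  \<open>M v\<close>, hence is not injective.\<close>

lemma merge_nodes_card:
  assumes M: "meta_ok F M" and e: "{u, v} \<in> E" and ne: "M u \<noteq> M v"
  shows "card (merge_nodes M u v ` V) < card (M ` V)"
proof -
  have uv: "u \<in> V" "v \<in> V" using edge_distinct[OF e] by auto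
  define f where "f A = (if A = M u \<or> A = M v then M u \<union> M v else A)" for A
  have "merge_nodes M u v x = f (M x)" for x
  proof -
    have "x \<in> M u \<union> M v \<longleftrightarrow> M x = M u \<or> M x = M v"
      using meta_okD(1,2)[OF M] by (metis Un_iff)
    then show ?thesis by (simp add: merge_nodes_def f_def)
  qed
  then have eq: "merge_nodes M u v ` V = f ` (M ` V)" by (simp add: image_image)
  have "f (M u) = f (M v)" by (simp add: f_def)
  then have "\<not> inj_on f (M ` V)" using ne uv by (auto simp: inj_on_def)
  moreover have fin: "finite (M ` V)" using finite_vertices by simp
  ultimately show ?thesis
    unfolding eq using card_image_le[OF fin, of f] eq_card_imp_inj_on[OF fin, of f]
    by linarith
qed

lemma rank_decreases:
  assumes "round1_step E r s s'" "invar s"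
  shows "(rank s', rank s) \<in> less_than <*lex*> less_than <*lex*> less_than"
  using assms(1)
proof cases
  case (select i T' F K R K' \<A> M)
  have "finite T'"
    using assms(2) finite_terminals finite_subset by (auto simp: select invar_def result_ok_def)
  then have "card (T' - {i}) < card T'" using select(3) by (rule card_Diff1_less)
  then show ?thesis by (simp add: select rank_def)
next
  case (reassign C K j T' F i P R \<A> M)
  then show ?thesis by (simp add: rank_def size_Diff1_less)
next
  case (merge u v F M T' \<A>)
  have "meta_ok F M" using assms(2) by (simp add: merge(1) invar_def)
  then show ?thesis using merge_nodes_card merge(3,5) by (simp add: merge(1,2) rank_def)
qed (simp_all add: rank_def)

text \<open>An innermost part of weight \<open>x\<close> exists once the chain weighs at least
  \<open>x\<close>. The cuts at \<open>r i\<close> include all cuts of \<open>i\<close>, so they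
  weigh at least 1; during the exchange the cuts of \<open>i\<close> weigh as much as
  \<open>K\<close>, hence at least \<open>wt C\<close>.\<close>

lemma stuck_imp_finished:
  assumes inv: "invar s" and stuck: "\<nexists>s'. round1_step E r s s'"
  shows "round1_finished s"
proof -
  obtain T' \<A> F M p where s: "s = \<lparr>pending = T', result = \<A>, fam = F, meta = M, phase = p\<rparr>"
    by (cases s)
  have F: "family_ok F" and fin: "finite T'"
    using inv finite_terminals finite_subset by (auto simp: s invar_def result_ok_def)
  have nn: "nonneg F" using F by (simp add: family_ok_def)
  show ?thesis
  proof (cases p)
    case Select
    have "T' = {}"
    proof (rule ccontr)
      assume "T' \<noteq> {}"
      then have "Max ((\<lambda>i. depth F (r i)) ` T') \<in> (\<lambda>i. depth F (r i)) ` T'"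
        using fin by (intro Max_in) auto
      then obtain i where "i \<in> T'" "depth F (r i) = Max ((\<lambda>i. depth F (r i)) ` T')" by auto
      then have i: "i \<in> T'" "\<forall>j\<in>T'. depth F (r j) \<le> depth F (r i)" using fin by simp_all
      have "1 = owner_mass i F" using inv i(1) by (simp add: s invar_def)
      also have "\<dots> \<le> mass (\<lambda>_ A. r i \<in> A) F"
        using F by (intro mass_mono[OF nn]) (auto simp: family_ok_def)
      finally have "1 \<le> weight (cuts_at F (r i))" by (simp add: cuts_at_def mass_def)
      moreover have "\<forall>C\<in>#cuts_at F (r i). \<forall>D\<in>#cuts_at F (r i).
          verts C \<subseteq> verts D \<or> verts D \<subseteq> verts C"
        using chain_at[OF F] by (auto simp: cuts_at_def)
      ultimately obtain K R where "innermost 1 (cuts_at F (r i)) K R"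
        using innermost_exists[of "cuts_at F (r i)" 1] by auto
      then show False using stuck round1_step.select[OF i] unfolding s Select by blast
    qed
    then show ?thesis by (simp add: s Select round1_finished_def)
  next
    case (Reassign i K)
    have K: "K \<subseteq># F" "owner_mass i F = weight K"
      using inv by (auto simp: s Reassign invar_def phase_ok_def)
    have nnK: "nonneg K" using nn K(1) by (rule nonneg_sub)
    obtain C where C: "C \<in># K" "owner C \<in> T'"
      using stuck round1_step.reassign_done unfolding s Reassign by metis
    have "weight K = wt C + weight (K - {#C#})"
      using C(1) by (metis insert_DiffM weight_simps(2))
    moreover have "0 \<le> weight (K - {#C#})"
      unfolding weight_eq_mass by (intro mass_nonneg nonneg_sub[OF nnK]) simp
    ultimately have "wt C \<le> weight (owned F i)"
      using K(2) unfolding owner_mass_eq_weight by linarith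
    moreover have "0 \<le> wt C" using nnK C(1) by (simp add: nonneg_def)
    ultimately obtain P R where "innermost (wt C) (owned F i) P R"
      using innermost_exists[of "owned F i" "wt C"] owned_chain[OF F] by blast
    then show ?thesis using stuck round1_step.reassign[OF C(1) refl C(2)] unfolding s Reassign by blast
  next
    case Merge
    then show ?thesis
      using stuck round1_step.merge round1_step.merge_done unfolding s by metis
  qed
qed

section \<open>Feasibility of the output\<close>

lemma finished_feasible:
  assumes inv: "invar s" and fin: "round1_finished s"
  shows "integral_feasible V E t r (\<lambda>e. c e + 1) terminals (result s)"
proof -
  have dom: "dom (result s) = terminals" and ok: "edges_ok (result s) (fam s)"
    and nn: "nonneg (fam s)"
    using inv fin
    by (auto simp: invar_def round1_finished_def result_ok_def phase_ok_def family_ok_def)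
  have "card {i \<in> terminals. e \<in> boundary E (the (result s i))} \<le> c e + 1" if e: "e \<in> E" for e
  proof -
    obtain u v where uv: "e = {u, v}" using edges[OF e] card_2_iff by metis
    have "edge_bound (c e) (crossings (result s) e) (side u v (fam s)) (side v u (fam s))"
      using ok e by (auto simp: uv edges_ok_def)
    then have "crossings (result s) e \<le> Suc (c e)"
      by (rule edge_bound_le) (intro mass_nonneg nn)+
    then show ?thesis by (simp add: crossings_def dom)
  qed
  then show ?thesis
    using inv dom unfolding integral_feasible_def invar_def result_ok_def by blast
qed

end

theorem lemma3:
  fixes V :: "'v set" and E :: "'v set set" and c :: "'v set \<Rightarrow> nat" and t :: 'v
    and k :: nat and S :: "nat \<Rightarrow> 'i set" and r :: "'i \<Rightarrow> 'v"
    and T :: "'i set" and \<C> :: "('i, 'v) family"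
  assumes "cscp V E c t k S r"
    and "fractional_laminar_family V r T \<C>"
    and "fractional_feasible E t k S r c T \<C>"
  shows "(\<nexists>\<sigma>. \<sigma> 0 = round1_init T \<C> \<and> (\<forall>n::nat. round1_step E r (\<sigma> n) (\<sigma> (Suc n)))) \<and>
    (\<forall>s. (round1_step E r)\<^sup>*\<^sup>* (round1_init T \<C>) s \<and> (\<nexists>s'. round1_step E r s s') \<longrightarrow>
       round1_finished s \<and> integral_feasible V E t r (\<lambda>e. c e + 1) T (result s))"
proof -
  interpret cscp V E c t k S r by (fact assms(1))
  note init = invar_init[OF assms(2,3)]
  have "\<nexists>\<sigma>. \<sigma> 0 = round1_init T \<C> \<and> (\<forall>n::nat. round1_step E r (\<sigma> n) (\<sigma> (Suc n)))"
  proof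
    assume "\<exists>\<sigma>. \<sigma> 0 = round1_init T \<C> \<and> (\<forall>n::nat. round1_step E r (\<sigma> n) (\<sigma> (Suc n)))"
    then obtain \<sigma> where \<sigma>: "\<sigma> 0 = round1_init T \<C>" "\<And>n. round1_step E r (\<sigma> n) (\<sigma> (Suc n))"
      by blast
    have "invar (\<sigma> n)" for n
      by (induction n) (use \<sigma> init(1) invar_step in auto)
    then have "(rank (\<sigma> (Suc n)), rank (\<sigma> n)) \<in> less_than <*lex*> less_than <*lex*> less_than" for n
      using \<sigma>(2) rank_decreases by blast
    \<comment> \<open>An infinite run would make the ranks descend forever in a well-founded
      order.\<close>
    then have "\<exists>f. \<forall>n. (f (Suc n), f n) \<in> less_than <*lex*> less_than <*lex*> less_than"
      by (intro exI[of _ "\<lambda>n. rank (\<sigma> n)"]) simp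
    moreover have "wf (less_than <*lex*> less_than <*lex*> less_than)"
      by (intro wf_lex_prod wf_less_than)
    ultimately show False
      unfolding wf_iff_no_infinite_down_chain by blast
  qed
  moreover have "invar s" if "(round1_step E r)\<^sup>*\<^sup>* (round1_init T \<C>) s" for s
    using that by induction (use init(1) invar_step in auto)
  then have "round1_finished s \<and> integral_feasible V E t r (\<lambda>e. c e + 1) T (result s)"
    if "(round1_step E r)\<^sup>*\<^sup>* (round1_init T \<C>) s" "\<nexists>s'. round1_step E r s s'" for s
    using that stuck_imp_finished finished_feasible init(2) by blast
  ultimately show ?thesis by blast
qed

end
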